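(* Let $G$ be a simple grid graph, let $\{V_1,\dots,V_K\}$ be a partition of $V(G)$, and for each $i$ let $G_i$ be the subgraph of $G$ induced by $V_i$. Assume that each $G_i$ is a simple grid graph. Let $\mathcal{C}$ be the set of cut edges, i.e. the edges of $G$ whose two endpoints belong to different sets $V_i$. Then $$|\mathcal{C}| = \mathrm{Area}(G) +K-1 - \sum_{i=1}^K \mathrm{Area}(G_i).$$
   Context: $\mathcal{L}(\mathbb{Z}^2)$ is the regular square lattice graph: its vertex set is $\mathbb{Z}^2$ and its edges join points at Euclidean distance $1$. A grid graph is a finite connected subgraph of $\mathcal{L}(\mathbb{Z}^2)$; $V(G)$ denotes the vertex set of $G$. A simple closed loop in $\mathcal{L}(\mathbb{Z}^2)$ is a sequence $\alpha$ of more than two distinct vertices in which each successive pair (including the pair consisting of the first and the last) is an edge of $\mathcal{L}(\mathbb{Z}^2)$. A grid graph $G$ is simple if it consists of all of the vertices and edges of $\mathcal{L}(\mathbb{Z}^2)$ that are on and interior to a simple closed loop $\alpha$; then $\mathrm{Area}(G)$ is the area of the interior of $\alpha$ (viewed as a piecewise-linear closed curve in $\mathbb{R}^2$), equivalently the number of faces of $G$ (unit lattice squares enclosed by $\alpha$). *)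

theory Defs
  imports "HOL-Analysis.Analysis"
begin

type_synonym vertex = "int \<times> int"

record graph =
  verts :: "vertex set"
  edges :: "vertex set set"

text \<open>The plane is represented by the type of complex numbers.\<close>

definition pt :: "vertex \<Rightarrow> complex" where
  "pt v = Complex (of_int (fst v)) (of_int (snd v))"

definition adj :: "vertex \<Rightarrow> vertex \<Rightarrow> bool" where
  "adj u v \<longleftrightarrow> dist (pt u) (pt v) = 1"

definition square_lattice :: graph where
  "square_lattice = \<lparr>verts = UNIV, edges = {{u, v} | u v. adj u v}\<rparr>"

definition subgraph :: "graph \<Rightarrow> graph \<Rightarrow> bool" where
  "subgraph H G \<longleftrightarrow> verts H \<subseteq> verts G \<and> edges H \<subseteq> edges G \<and> (\<forall>e \<in> edges H. e \<subseteq> verts H)"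

definition connected_graph :: "graph \<Rightarrow> bool" where
  "connected_graph G \<longleftrightarrow> verts G \<noteq> {} \<and>
     (\<forall>u \<in> verts G. \<forall>v \<in> verts G. (u, v) \<in> {(x, y). {x, y} \<in> edges G}\<^sup>*)"

definition grid_graph :: "graph \<Rightarrow> bool" where
  "grid_graph G \<longleftrightarrow> subgraph G square_lattice \<and> finite (verts G) \<and> connected_graph G"

definition induced_subgraph :: "graph \<Rightarrow> vertex set \<Rightarrow> graph" where
  "induced_subgraph G W = \<lparr>verts = verts G \<inter> W, edges = {e \<in> edges G. e \<subseteq> W}\<rparr>"

definition simple_closed_loop :: "vertex list \<Rightarrow> bool" where
  "simple_closed_loop \<alpha> \<longleftrightarrow> length \<alpha> > 2 \<and> distinct \<alpha> \<and>
     (\<forall>i < length \<alpha>. {\<alpha> ! i, \<alpha> ! (Suc i mod length \<alpha>)} \<in> edges square_lattice)"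

definition loop_curve :: "vertex list \<Rightarrow> complex set" where
  "loop_curve \<alpha> =
     (\<Union>i < length \<alpha>. closed_segment (pt (\<alpha> ! i)) (pt (\<alpha> ! (Suc i mod length \<alpha>))))"

definition loop_region :: "vertex list \<Rightarrow> complex set" where
  "loop_region \<alpha> = loop_curve \<alpha> \<union> inside (loop_curve \<alpha>)"

definition loop_graph :: "vertex list \<Rightarrow> graph" where
  "loop_graph \<alpha> = \<lparr>verts = {v. pt v \<in> loop_region \<alpha>},
     edges = {{u, v} | u v. adj u v \<and> closed_segment (pt u) (pt v) \<subseteq> loop_region \<alpha>}\<rparr>"

definition simple_grid_graph :: "graph \<Rightarrow> bool" where
  "simple_grid_graph G \<longleftrightarrow> grid_graph G \<and> (\<exists>\<alpha>. simple_closed_loop \<alpha> \<and> G = loop_graph \<alpha>)"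

text \<open>The area does not depend on the choice of the bounding loop; see \<open>area_loop_graph\<close> below.\<close>

definition area :: "graph \<Rightarrow> real" where
  "area G = (THE a. \<exists>\<alpha>. simple_closed_loop \<alpha> \<and> G = loop_graph \<alpha> \<and>
                        a = measure lebesgue (inside (loop_curve \<alpha>)))"

definition cut_edges :: "graph \<Rightarrow> vertex set set \<Rightarrow> vertex set set" where
  "cut_edges G P =
     {e \<in> edges G. \<exists>u v. e = {u, v} \<and> (\<exists>A \<in> P. \<exists>B \<in> P. A \<noteq> B \<and> u \<in> A \<and> v \<in> B)}"

lemma loop_curve_subset:
  assumes "simple_closed_loop \<alpha>" "loop_graph \<alpha> = loop_graph \<beta>"
  shows "loop_curve \<alpha> \<subseteq> loop_region \<beta>"
proof -
  have "closed_segment (pt (\<alpha> ! i)) (pt (\<alpha> ! (Suc i mod length \<alpha>))) \<subseteq> loop_region \<beta>"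
    if i: "i < length \<alpha>" for i
  proof -
    let ?u = "\<alpha> ! i" and ?v = "\<alpha> ! (Suc i mod length \<alpha>)"
    have "{?u, ?v} \<in> edges square_lattice"
      using assms(1) i by (simp add: simple_closed_loop_def)
    then have "adj ?u ?v"
      by (auto simp: square_lattice_def doubleton_eq_iff adj_def dist_commute)
    moreover have "closed_segment (pt ?u) (pt ?v) \<subseteq> loop_region \<alpha>"
      using i by (auto simp: loop_region_def loop_curve_def)
    ultimately have "{?u, ?v} \<in> edges (loop_graph \<beta>)"
      unfolding assms(2)[symmetric] unfolding loop_graph_def graph.simps by blast
    then obtain x y where "{?u, ?v} = {x, y}" "closed_segment (pt x) (pt y) \<subseteq> loop_region \<beta>"
      by (auto simp: loop_graph_def)
    then show ?thesis
      by (metis doubleton_eq_iff closed_segment_commute)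
  qed
  then show ?thesis
    unfolding loop_curve_def by blast
qed

lemma loop_region_mono:
  assumes "simple_closed_loop \<alpha>" "loop_graph \<alpha> = loop_graph \<beta>"
  shows "loop_region \<alpha> \<subseteq> loop_region \<beta>"
proof -
  have "outside (loop_curve \<beta>) \<subseteq> outside (loop_curve \<alpha>)"
  proof
    fix x assume x: "x \<in> outside (loop_curve \<beta>)"
    let ?C = "connected_component_set (- loop_curve \<beta>) x"
    have "?C \<subseteq> outside (loop_curve \<beta>)"
      using x outside_same_component by blast
    then have "?C \<subseteq> - loop_curve \<alpha>"
      using loop_curve_subset[OF assms] unfolding loop_region_def union_with_inside by blast
    moreover have "x \<in> ?C"
      using x by (auto simp: outside_def)
    ultimately have "?C \<subseteq> connected_component_set (- loop_curve \<alpha>) x"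
      by (simp add: connected_component_maximal)
    moreover have "x \<notin> loop_curve \<alpha>"
      using \<open>x \<in> ?C\<close> \<open>?C \<subseteq> - loop_curve \<alpha>\<close> by blast
    ultimately show "x \<in> outside (loop_curve \<alpha>)"
      using x bounded_subset[of "connected_component_set (- loop_curve \<alpha>) x" ?C]
      by (auto simp: outside_def)
  qed
  then show ?thesis
    unfolding loop_region_def union_with_inside by (rule Compl_anti_mono)
qed

lemma negligible_loop_curve: "negligible (loop_curve \<alpha>)"
proof -
  have "negligible (closed_segment a b)" for a b :: complex
  proof -
    have "aff_dim (closed_segment a b) \<le> int (card {a, b}) - 1"
      unfolding segment_convex_hull aff_dim_convex_hull by (rule aff_dim_le_card) simp
    also have "\<dots> < int (DIM(complex))"
      by (simp add: card_insert_if)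
    finally have "interior (closed_segment a b) = {}"
      using aff_dim_nonempty_interior[of "closed_segment a b"] by linarith
    then show ?thesis
      by (simp add: negligible_convex_interior)
  qed
  then show ?thesis
    unfolding loop_curve_def by (intro negligible_Union) auto
qed

lemma area_loop_graph:
  assumes "simple_closed_loop \<alpha>"
  shows "area (loop_graph \<alpha>) = measure lebesgue (inside (loop_curve \<alpha>))"
proof -
  have region: "measure lebesgue (inside (loop_curve \<beta>)) = measure lebesgue (loop_region \<beta>)" for \<beta>
  proof (rule measure_negligible_symdiff)
    have "compact (loop_curve \<beta>)"
      unfolding loop_curve_def by (intro compact_UN) auto
    then have "bounded (loop_region \<beta>)" "closed (- outside (loop_curve \<beta>))"
      using bounded_inside[of "loop_curve \<beta>"] open_outside[of "loop_curve \<beta>"]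
      by (auto simp: loop_region_def compact_imp_bounded compact_imp_closed)
    moreover have "loop_region \<beta> = - outside (loop_curve \<beta>)"
      by (simp add: loop_region_def union_with_inside)
    ultimately show "loop_region \<beta> \<in> lmeasurable"
      by (simp add: compact_eq_bounded_closed lmeasurable_compact)
    show "negligible (loop_region \<beta> - inside (loop_curve \<beta>) \<union>
        (inside (loop_curve \<beta>) - loop_region \<beta>))"
      by (rule negligible_subset[OF negligible_loop_curve[of \<beta>]]) (auto simp: loop_region_def)
  qed
  have unique: "measure lebesgue (inside (loop_curve \<beta>)) = measure lebesgue (inside (loop_curve \<alpha>))"
    if "simple_closed_loop \<beta>" "loop_graph \<alpha> = loop_graph \<beta>" for \<beta>
  proof -
    have "loop_region \<beta> = loop_region \<alpha>"
      using loop_region_mono[OF assms that(2)] loop_region_mono[OF that(1) that(2)[symmetric]]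
      by (rule subset_antisym[rotated])
    then show ?thesis
      by (simp only: region)
  qed
  show ?thesis
    unfolding area_def
  proof (rule the_equality)
    show "\<exists>\<beta>. simple_closed_loop \<beta> \<and> loop_graph \<alpha> = loop_graph \<beta> \<and>
        measure lebesgue (inside (loop_curve \<alpha>)) = measure lebesgue (inside (loop_curve \<beta>))"
      using assms by blast
  qed (use unique in blast)
qed

end

theory Submission
  imports Defs
begin

text \<open>
  The identity is Euler's formula, applied once to \<open>G\<close> and once to every part. For a simple grid
  graph \<open>H\<close> the formula reads \<open>card (edges H) = card (verts H) + area H - 1\<close>, because the area
  counts the bounded unit faces (lemma \<open>euler_simple_grid_graph\<close>). The edges of \<open>G\<close> that are not
  cut are distributed over the induced subgraphs (lemma \<open>edges_partition\<close>). Subtracting the formulas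
  for the parts from the formula for \<open>G\<close>, the vertex counts cancel, and each of the \<open>K\<close> parts
  contributes one unit besides its area.

  Euler's formula for a loop \<open>\<alpha>\<close> is proved by induction on the integer part of the enclosed area. If
  some edge of the loop graph does not belong to \<open>\<alpha>\<close>, extend it in both directions along its
  lattice line until \<open>\<alpha>\<close> is met; this gives a straight chord through the interior (lemma
  \<open>chord_exists\<close>). By the theta curve theorem \<open>split_inside_simple_closed_curve\<close> the chord cuts the
  region into two loop regions which overlap exactly in the chord (lemma \<open>chord_split\<close>). A chord
  has one vertex more than it has edges, so Euler's formula for the two pieces implies Euler's formula for
  \<open>\<alpha>\<close> (lemma \<open>euler_glue\<close>). Each piece contains a unit square, so both areas drop by at
  least one. If, on the other hand, all edges of the loop graph belong to \<open>\<alpha>\<close>, then the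
  interior is a single unit square (lemma \<open>inside_eq_unit_square\<close>), and \<open>\<alpha>\<close> has as many
  vertices as edges (lemma \<open>euler_base\<close>).

  Working with the set of edges of a walk or loop turns statements about plane curves into
  combinatorics: two distinct lattice edges meet in common endpoints only (lemma
  \<open>seg_Int_seg\<close>), so intersections of drawings can be read off the vertex sets.
\<close>

section \<open>Lattice edges as segments\<close>

text \<open>The convex hull makes the segment a function of the unordered edge.\<close>

definition seg :: "vertex set \<Rightarrow> complex set" where
  "seg e = convex hull (pt ` e)"

lemma seg_doubleton: "seg {u, v} = closed_segment (pt u) (pt v)"
  by (simp add: seg_def segment_convex_hull)

lemma inj_pt: "inj pt"
  by (auto simp: inj_on_def pt_def prod_eq_iff)

lemma adj_iff: "adj u v \<longleftrightarrow> \<bar>fst u - fst v\<bar> + \<bar>snd u - snd v\<bar> = 1"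
proof -
  let ?a = "fst u - fst v" and ?b = "snd u - snd v"
  have "dist (pt u) (pt v) = sqrt (of_int (?a\<^sup>2 + ?b\<^sup>2))"
    by (simp add: pt_def dist_complex_def cmod_def)
  then have "adj u v \<longleftrightarrow> ?a\<^sup>2 + ?b\<^sup>2 = 1"
    unfolding adj_def by (metis of_int_eq_1_iff real_sqrt_eq_1_iff)
  also have "\<dots> \<longleftrightarrow> \<bar>?a\<bar> + \<bar>?b\<bar> = 1"
  proof
    assume *: "?a\<^sup>2 + ?b\<^sup>2 = 1"
    then have "\<bar>?a\<bar> \<le> 1" "\<bar>?b\<bar> \<le> 1"
      using abs_square_le_1[of ?a] abs_square_le_1[of ?b] by (smt (verit) zero_le_power2)+
    then have "?a \<in> {-1, 0, 1}" "?b \<in> {-1, 0, 1}"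
      by auto
    then show "\<bar>?a\<bar> + \<bar>?b\<bar> = 1"
      using * by auto
  next
    assume "\<bar>?a\<bar> + \<bar>?b\<bar> = 1"
    then have "(?a = 0 \<and> (?b = 1 \<or> ?b = -1)) \<or> (?b = 0 \<and> (?a = 1 \<or> ?a = -1))"
      by linarith
    then show "?a\<^sup>2 + ?b\<^sup>2 = 1"
      by auto
  qed
  finally show ?thesis .
qed

lemma edge_iff: "{u, v} \<in> edges square_lattice \<longleftrightarrow> adj u v"
  unfolding square_lattice_def graph.simps mem_Collect_eq doubleton_eq_iff adj_def
  by (metis dist_commute)

lemma lattice_edge_cases:
  assumes "e \<in> edges square_lattice"
  obtains (horizontal) a b where "e = {(a, b), (a + 1, b)}"
  | (vertical) a b where "e = {(a, b), (a, b + 1)}"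
proof -
  obtain a b c d where e: "e = {(a, b), (c, d)}" and "adj (a, b) (c, d)"
    using assms by (auto simp: square_lattice_def)
  then have "\<bar>a - c\<bar> + \<bar>b - d\<bar> = 1"
    by (simp add: adj_iff)
  then consider "b = d" "c = a + 1" | "b = d" "a = c + 1" | "a = c" "d = b + 1" | "a = c" "b = d + 1"
    by linarith
  then show thesis
    by cases (use e that in \<open>auto simp: insert_commute\<close>)
qed

lemma seg_horizontal:
  "seg {(a, b), (a + 1, b)} = {z. Im z = of_int b \<and> of_int a \<le> Re z \<and> Re z \<le> of_int a + 1}"
proof -
  have "z \<in> closed_segment (pt (a, b)) (pt (a + 1, b)) \<longleftrightarrow>
      Im z = of_int b \<and> of_int a \<le> Re z \<and> Re z \<le> of_int a + 1" for z
  proof -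
    have "z \<in> closed_segment (pt (a, b)) (pt (a + 1, b)) \<longleftrightarrow>
       (\<exists>u\<ge>0. u \<le> 1 \<and> Re z = of_int a + u \<and> Im z = of_int b)"
      by (auto simp: closed_segment_def pt_def complex_eq_iff algebra_simps)
    also have "\<dots> \<longleftrightarrow> Im z = of_int b \<and> of_int a \<le> Re z \<and> Re z \<le> of_int a + 1"
      by (auto intro!: exI[of _ "Re z - of_int a"])
    finally show ?thesis .
  qed
  then show ?thesis
    by (auto simp: seg_doubleton)
qed

lemma seg_vertical:
  "seg {(a, b), (a, b + 1)} = {z. Re z = of_int a \<and> of_int b \<le> Im z \<and> Im z \<le> of_int b + 1}"
proof -
  have "z \<in> closed_segment (pt (a, b)) (pt (a, b + 1)) \<longleftrightarrow>
      Re z = of_int a \<and> of_int b \<le> Im z \<and> Im z \<le> of_int b + 1" for z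
  proof -
    have "z \<in> closed_segment (pt (a, b)) (pt (a, b + 1)) \<longleftrightarrow>
       (\<exists>u\<ge>0. u \<le> 1 \<and> Im z = of_int b + u \<and> Re z = of_int a)"
      by (auto simp: closed_segment_def pt_def complex_eq_iff algebra_simps)
    also have "\<dots> \<longleftrightarrow> Re z = of_int a \<and> of_int b \<le> Im z \<and> Im z \<le> of_int b + 1"
      by (auto intro!: exI[of _ "Im z - of_int b"])
    finally show ?thesis .
  qed
  then show ?thesis
    by (auto simp: seg_doubleton)
qed

lemma pt_in_seg:
  assumes "e \<in> edges square_lattice"
  shows "pt w \<in> seg e \<longleftrightarrow> w \<in> e"
  using assms
proof (cases rule: lattice_edge_cases)
  case (horizontal a b)
  then show ?thesis
    unfolding seg_horizontal horizontal by (cases w) (auto simp: pt_def)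
next
  case (vertical a b)
  then show ?thesis
    unfolding seg_vertical vertical by (cases w) (auto simp: pt_def)
qed

text \<open>A common point of two segments of different edges has two integral coordinates: for
  perpendicular edges each one supplies a coordinate, for parallel edges the unit intervals are
  different and touch at an integer. A lattice point of a segment is an endpoint.\<close>

lemma seg_Int_seg:
  assumes e: "e \<in> edges square_lattice" and f: "f \<in> edges square_lattice" and "e \<noteq> f"
  shows "seg e \<inter> seg f \<subseteq> pt ` (e \<inter> f)"
proof
  fix z assume z: "z \<in> seg e \<inter> seg f"
  have "\<exists>w. z = pt w"
    using e
  proof (cases rule: lattice_edge_cases)
    case ee: (horizontal a b)
    show ?thesis
      using f
    proof (cases rule: lattice_edge_cases)
      case ff: (horizontal c d)
      have "b = d" "a \<noteq> c"
        using z \<open>e \<noteq> f\<close> by (auto simp: ee ff seg_horizontal)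
      moreover have "of_int a \<le> Re z" "Re z \<le> of_int a + 1" "of_int c \<le> Re z" "Re z \<le> of_int c + 1"
        using z by (auto simp: ee ff seg_horizontal)
      moreover from this have "a \<le> c + 1" "c \<le> a + 1" by linarith+
      ultimately have "Re z = of_int (max a c)"
        by (auto simp: max_def)
      then have "z = pt (max a c, b)"
        using z by (auto simp: ee seg_horizontal pt_def complex_eq_iff)
      then show ?thesis ..
    next
      case (vertical c d)
      then have "z = pt (c, b)"
        using z by (auto simp: ee seg_horizontal seg_vertical pt_def complex_eq_iff)
      then show ?thesis ..
    qed
  next
    case ee: (vertical a b)
    show ?thesis
      using f
    proof (cases rule: lattice_edge_cases)
      case ff: (vertical c d)
      have "a = c" "b \<noteq> d"
        using z \<open>e \<noteq> f\<close> by (auto simp: ee ff seg_vertical)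
      moreover have "of_int b \<le> Im z" "Im z \<le> of_int b + 1" "of_int d \<le> Im z" "Im z \<le> of_int d + 1"
        using z by (auto simp: ee ff seg_vertical)
      moreover from this have "b \<le> d + 1" "d \<le> b + 1" by linarith+
      ultimately have "Im z = of_int (max b d)"
        by (auto simp: max_def)
      then have "z = pt (a, max b d)"
        using z by (auto simp: ee seg_vertical pt_def complex_eq_iff)
      then show ?thesis ..
    next
      case (horizontal c d)
      then have "z = pt (a, d)"
        using z by (auto simp: ee seg_horizontal seg_vertical pt_def complex_eq_iff)
      then show ?thesis ..
    qed
  qed
  then show "z \<in> pt ` (e \<inter> f)"
    using z pt_in_seg e f by blast
qed

definition drawing :: "vertex set set \<Rightarrow> complex set" where
  "drawing S = (\<Union>e\<in>S. seg e)"

lemma drawing_Un: "drawing (S \<union> T) = drawing S \<union> drawing T"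
  by (simp add: drawing_def)

lemma pt_in_drawing:
  assumes "S \<subseteq> edges square_lattice"
  shows "pt w \<in> drawing S \<longleftrightarrow> w \<in> \<Union>S"
  using assms pt_in_seg unfolding drawing_def by blast

lemma drawing_Int:
  assumes "S \<subseteq> edges square_lattice" "T \<subseteq> edges square_lattice" "S \<inter> T = {}"
  shows "drawing S \<inter> drawing T = pt ` (\<Union>S \<inter> \<Union>T)"
proof
  show "drawing S \<inter> drawing T \<subseteq> pt ` (\<Union>S \<inter> \<Union>T)"
  proof
    fix z assume "z \<in> drawing S \<inter> drawing T"
    then obtain e f where "e \<in> S" "f \<in> T" "z \<in> seg e" "z \<in> seg f"
      by (auto simp: drawing_def)
    then show "z \<in> pt ` (\<Union>S \<inter> \<Union>T)"
      using seg_Int_seg[of e f] assms by blast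
  qed
  show "pt ` (\<Union>S \<inter> \<Union>T) \<subseteq> drawing S \<inter> drawing T"
    using pt_in_drawing assms by blast
qed

definition open_seg :: "vertex set \<Rightarrow> complex set" where
  "open_seg e = seg e - pt ` e"

lemma open_seg_doubleton: "open_seg {u, v} = open_segment (pt u) (pt v)"
  by (auto simp: open_seg_def open_segment_def seg_doubleton)

lemma open_seg_properties:
  assumes "e \<in> edges square_lattice"
  shows "open_seg e \<noteq> {}" "connected (open_seg e)" "closure (open_seg e) = seg e"
proof -
  obtain u v where e: "e = {u, v}" "adj u v"
    using assms by (auto simp: square_lattice_def)
  then have "pt u \<noteq> pt v"
    by (auto simp: adj_def)
  then show "open_seg e \<noteq> {}" "connected (open_seg e)" "closure (open_seg e) = seg e"
    by (auto simp: e open_seg_doubleton seg_doubleton convex_connected convex_open_segment)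
qed

text \<open>An edge outside \<open>S\<close> meets the drawing of \<open>S\<close> in its endpoints at most. Hence an open edge either
  belongs to a loop or avoids its curve completely; it never crosses it.\<close>

lemma open_seg_disjoint_drawing:
  assumes "S \<subseteq> edges square_lattice" "e \<in> edges square_lattice" "e \<notin> S"
  shows "open_seg e \<inter> drawing S = {}"
proof -
  have "seg e \<inter> drawing S \<subseteq> pt ` e"
    using drawing_Int[of "{e}" S] assms by (auto simp: drawing_def)
  then show ?thesis
    by (auto simp: open_seg_def)
qed

lemma seg_subset_drawing_iff:
  assumes "S \<subseteq> edges square_lattice" "e \<in> edges square_lattice"
  shows "seg e \<subseteq> drawing S \<longleftrightarrow> e \<in> S"
proof
  assume "seg e \<subseteq> drawing S"
  then show "e \<in> S"
    using open_seg_disjoint_drawing[OF assms] open_seg_properties(1)[OF assms(2)]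
    by (force simp: open_seg_def)
qed (auto simp: drawing_def)

section \<open>Walks and loops as edge sets\<close>

fun walk_edges :: "vertex list \<Rightarrow> vertex set set" where
  "walk_edges (x # y # xs) = insert {x, y} (walk_edges (y # xs))"
| "walk_edges _ = {}"

definition cycle_edges :: "vertex list \<Rightarrow> vertex set set" where
  "cycle_edges \<alpha> = walk_edges (\<alpha> @ [hd \<alpha>])"

lemma walk_edges_conv_nth: "walk_edges xs = {{xs ! i, xs ! Suc i} | i. Suc i < length xs}"
proof (induction xs rule: walk_edges.induct)
  case (1 x y xs)
  have "{{(x # y # xs) ! i, (x # y # xs) ! Suc i} | i. Suc i < length (x # y # xs)} =
      insert {x, y} {{(y # xs) ! i, (y # xs) ! Suc i} | i. Suc i < length (y # xs)}" (is "?L = ?R")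
  proof
    show "?L \<subseteq> ?R"
    proof
      fix e assume "e \<in> ?L"
      then obtain i where "e = {(x # y # xs) ! i, (x # y # xs) ! Suc i}" "Suc i < length (x # y # xs)"
        by blast
      then show "e \<in> ?R"
        by (cases i) auto
    qed
    show "?R \<subseteq> ?L"
    proof
      fix e assume "e \<in> ?R"
      then consider "e = {x, y}" | i where "e = {(y # xs) ! i, (y # xs) ! Suc i}" "Suc i < length (y # xs)"
        by blast
      then show "e \<in> ?L"
      proof cases
        case 1
        then have "e = {(x # y # xs) ! 0, (x # y # xs) ! Suc 0} \<and> Suc 0 < length (x # y # xs)" by simp
        then show ?thesis by blast
      next
        case 2
        then have "e = {(x # y # xs) ! Suc i, (x # y # xs) ! Suc (Suc i)} \<and> Suc (Suc i) < length (x # y # xs)"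
          by simp
        then show ?thesis by blast
      qed
    qed
  qed
  then show ?case
    using 1 by simp
qed auto

lemma cycle_edges_conv_nth:
  "cycle_edges \<alpha> = (\<lambda>i. {\<alpha> ! i, \<alpha> ! (Suc i mod length \<alpha>)}) ` {..<length \<alpha>}"
proof (cases "\<alpha> = []")
  case True
  then show ?thesis by (simp add: cycle_edges_def)
next
  case False
  have "(\<alpha> @ [hd \<alpha>]) ! Suc i = \<alpha> ! (Suc i mod length \<alpha>)" if "i < length \<alpha>" for i
    using that False by (cases "Suc i = length \<alpha>") (auto simp: nth_append hd_conv_nth)
  then show ?thesis
    unfolding cycle_edges_def walk_edges_conv_nth
    by (auto simp: nth_append image_def)
qed

lemma walk_edges_append: "walk_edges (xs @ y # ys) = walk_edges (xs @ [y]) \<union> walk_edges (y # ys)"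
  by (induction xs rule: walk_edges.induct) auto

lemma walk_edges_rev: "walk_edges (rev xs) = walk_edges xs"
proof (induction xs rule: walk_edges.induct)
  case (1 x y xs)
  have "walk_edges (rev (x # y # xs)) = walk_edges (rev xs @ [y]) \<union> walk_edges [y, x]"
    using walk_edges_append[of "rev xs" y "[x]"] by simp
  then show ?case
    using 1 by (auto simp: insert_commute)
qed auto

lemma Union_walk_edges: "\<Union>(walk_edges (x # y # xs)) = set (x # y # xs)"
  by (induction xs arbitrary: x y) auto

lemma simple_closed_loop_iff:
  "simple_closed_loop \<alpha> \<longleftrightarrow> length \<alpha> > 2 \<and> distinct \<alpha> \<and> cycle_edges \<alpha> \<subseteq> edges square_lattice"
  by (auto simp: simple_closed_loop_def cycle_edges_conv_nth)

lemma loop_curve_eq_drawing: "loop_curve \<alpha> = drawing (cycle_edges \<alpha>)"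
  by (auto simp: loop_curve_def cycle_edges_conv_nth drawing_def seg_doubleton)

text \<open>Two positions with the same edge would have to be successors of each other, which is
  impossible in a cycle with more than two vertices.\<close>

lemma card_cycle_edges:
  assumes "simple_closed_loop \<alpha>"
  shows "card (cycle_edges \<alpha>) = length \<alpha>"
proof -
  let ?n = "length \<alpha>"
  have n: "?n > 2" and d: "distinct \<alpha>"
    using assms by (auto simp: simple_closed_loop_def)
  have "i = j" if ij: "i < ?n" "j < ?n"
    and eq: "{\<alpha> ! i, \<alpha> ! (Suc i mod ?n)} = {\<alpha> ! j, \<alpha> ! (Suc j mod ?n)}" for i j
  proof (rule ccontr)
    assume "i \<noteq> j"
    have "Suc i mod ?n < ?n" "Suc j mod ?n < ?n"
      using n by (auto intro!: mod_less_divisor)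
    then have "i = Suc j mod ?n" "j = Suc i mod ?n"
      using eq ij d \<open>i \<noteq> j\<close> by (auto simp: doubleton_eq_iff nth_eq_iff_index_eq)
    moreover have "Suc k mod ?n = (if Suc k = ?n then 0 else Suc k)" if "k < ?n" for k
      using that by auto
    ultimately show False
      using n ij by (auto split: if_splits)
  qed
  then have "inj_on (\<lambda>i. {\<alpha> ! i, \<alpha> ! (Suc i mod ?n)}) {..<?n}"
    by (auto intro!: inj_onI)
  then show ?thesis
    by (simp add: cycle_edges_conv_nth card_image)
qed

lemma Union_cycle_edges:
  assumes "simple_closed_loop \<alpha>"
  shows "\<Union>(cycle_edges \<alpha>) = set \<alpha>"
proof (cases \<alpha>)
  case (Cons x xs)
  then show ?thesis
    using Union_walk_edges[of x] by (cases xs) (auto simp: cycle_edges_def)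
qed (use assms in \<open>simp add: simple_closed_loop_iff\<close>)

lemma cycle_edges_rotate: "cycle_edges (rotate k \<alpha>) = cycle_edges \<alpha>"
proof (induction k)
  case (Suc k)
  have "cycle_edges (rotate1 \<beta>) = cycle_edges \<beta>" for \<beta>
  proof (cases \<beta>)
    case (Cons x xs)
    show ?thesis
    proof (cases xs)
      case (Cons y ys)
      have "cycle_edges (rotate1 \<beta>) = walk_edges ((y # ys) @ x # [y])"
        by (simp add: cycle_edges_def \<open>\<beta> = _\<close> Cons)
      also have "\<dots> = walk_edges ((y # ys) @ [x]) \<union> {{x, y}}"
        by (subst walk_edges_append) simp
      finally show ?thesis
        by (auto simp: cycle_edges_def \<open>\<beta> = _\<close> Cons)
    qed (simp add: Cons)
  qed simp
  then show ?case
    using Suc by (simp add: rotate_Suc)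
qed simp

section \<open>Plane curves drawn by walks and loops\<close>

text \<open>Consecutive segments of a walk without repeated vertices are joined one by one: the new first
  vertex does not occur later, so the new segment meets the rest in one point only.\<close>

lemma walk_arc:
  assumes "distinct (x # y # xs)" "walk_edges (x # y # xs) \<subseteq> edges square_lattice"
  obtains g where "arc g" "pathstart g = pt x" "pathfinish g = pt (last (y # xs))"
    "path_image g = drawing (walk_edges (x # y # xs))"
  using assms
proof (induction xs arbitrary: x y thesis)
  case Nil
  have "arc (linepath (pt x) (pt y))"
    using Nil.prems(2) inj_pt by (auto simp: inj_eq)
  then show ?case
    using Nil.prems(1)[of "linepath (pt x) (pt y)"] by (simp add: drawing_def seg_doubleton)
next
  case (Cons z xs)
  let ?W = "walk_edges (y # z # xs)"
  obtain g where g: "arc g" "pathstart g = pt y" "pathfinish g = pt (last (z # xs))"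
    "path_image g = drawing ?W"
    using Cons.IH[of y z] Cons.prems(2,3) by auto
  have "\<Union>?W = set (y # z # xs)"
    by (rule Union_walk_edges)
  then have "{x, y} \<notin> ?W" "\<Union>{{x, y}} \<inter> \<Union>?W = {y}"
    using Cons.prems(2) by auto
  then have "drawing {{x, y}} \<inter> drawing ?W = {pt y}"
    using Cons.prems(3) by (subst drawing_Int) auto
  moreover have "arc (linepath (pt x) (pt y))"
    using Cons.prems(2) inj_pt by (auto simp: inj_eq)
  ultimately have "arc (linepath (pt x) (pt y) +++ g)"
    using g by (intro arc_join) (auto simp: drawing_def seg_doubleton)
  then show ?case
    using Cons.prems(1)[of "linepath (pt x) (pt y) +++ g"] g
    by (simp add: path_image_join drawing_def seg_doubleton)
qed

lemma walk_arc_append: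
  assumes "distinct (x # zs @ [y])" "walk_edges (x # zs @ [y]) \<subseteq> edges square_lattice"
  obtains g where "arc g" "pathstart g = pt x" "pathfinish g = pt y"
    "path_image g = drawing (walk_edges (x # zs @ [y]))"
proof (cases zs)
  case Nil
  then show ?thesis
    using walk_arc[of x y "[]"] assms that by auto
next
  case (Cons z ws)
  then show ?thesis
    using walk_arc[of x z "ws @ [y]"] assms that by auto
qed

text \<open>Rules out that a walk with an interior vertex uses the edge between its ends; this separates the two
  arcs of a loop.\<close>

lemma ends_notin_walk_edges:
  assumes "distinct (x # zs @ [y])" "zs \<noteq> []"
  shows "{x, y} \<notin> walk_edges (x # zs @ [y])"
proof -
  obtain z ws where zs: "zs = z # ws"
    using assms(2) by (cases zs) auto
  have "\<Union>(walk_edges (z # ws @ [y])) = set (z # ws @ [y])"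
    using Union_walk_edges[of z] by (cases ws) auto
  then have "{x, y} \<notin> walk_edges (z # ws @ [y])"
    using assms(1) zs by auto
  then show ?thesis
    using assms(1) by (auto simp: zs doubleton_eq_iff)
qed

lemma Union_walk_edges_append: "\<Union>(walk_edges (x # zs @ [y])) = set (x # zs @ [y])"
  using Union_walk_edges[of x] by (cases zs) auto

lemma cycle_edges_split:
  "cycle_edges (x # xs @ y # ys) = walk_edges (x # xs @ [y]) \<union> walk_edges (y # ys @ [x])"
  using walk_edges_append[of "x # xs" y "ys @ [x]"] by (simp add: cycle_edges_def)

text \<open>Apart from \<open>x\<close> and \<open>y\<close> the arcs have no common vertex, so a common edge could only be \<open>{x, y}\<close>, and
  then both arcs would consist of that edge alone and the loop would have two vertices.\<close>

lemma loop_arcs_Int: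
  assumes "simple_closed_loop (x # xs @ y # ys)"
  shows "drawing (walk_edges (x # xs @ [y])) \<inter> drawing (walk_edges (y # ys @ [x])) = {pt x, pt y}"
    (is "drawing ?S \<inter> drawing ?T = _")
proof -
  have d: "distinct (x # xs @ y # ys)" and n: "length (x # xs @ y # ys) > 2"
    and E: "?S \<subseteq> edges square_lattice" "?T \<subseteq> edges square_lattice"
    using assms by (auto simp: simple_closed_loop_iff cycle_edges_split)
  have int: "\<Union>?S \<inter> \<Union>?T = {x, y}"
    using d unfolding Union_walk_edges_append by auto
  have disj: "?S \<inter> ?T = {}"
  proof (rule ccontr)
    assume "?S \<inter> ?T \<noteq> {}"
    then obtain e where e: "e \<in> ?S" "e \<in> ?T"
      by blast
    obtain u v where uv: "e = {u, v}" "adj u v"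
      using e E by (auto simp: square_lattice_def)
    then have "u \<noteq> v"
      by (auto simp: adj_def)
    moreover have "e \<subseteq> {x, y}"
      using e int by blast
    ultimately have "e = {x, y}"
      using uv by auto
    then have "xs = []" "ys = []"
      using ends_notin_walk_edges[of x xs y] ends_notin_walk_edges[of y ys x] d e
      by (auto simp: insert_commute)
    then show False
      using n by simp
  qed
  show ?thesis
    using drawing_Int[OF E disj] int by simp
qed

lemma loop_curve_simple_path:
  assumes "simple_closed_loop \<alpha>"
  obtains c where "simple_path c" "pathfinish c = pathstart c" "path_image c = loop_curve \<alpha>"
proof -
  have "length \<alpha> > 2"
    using assms by (simp add: simple_closed_loop_iff)
  then obtain x y ys where \<alpha>: "\<alpha> = x # [] @ y # ys"
    by (metis (no_types, lifting) append_Nil length_0_conv length_Suc_conv less_zeroE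
        list.exhaust not_less_eq numeral_2_eq_2 zero_less_Suc)
  have d: "distinct (x # [] @ [y])" "distinct (y # ys @ [x])"
    and E: "walk_edges (x # [] @ [y]) \<subseteq> edges square_lattice"
      "walk_edges (y # ys @ [x]) \<subseteq> edges square_lattice"
    using assms unfolding \<alpha> simple_closed_loop_iff cycle_edges_split by auto
  \<comment> \<open>The first edge and the remaining walk back to the first vertex are two arcs with common ends.\<close>
  obtain g where g: "arc g" "pathstart g = pt x" "pathfinish g = pt y"
    "path_image g = drawing (walk_edges (x # [] @ [y]))"
    using walk_arc_append[OF d(1) E(1)] .
  obtain h where h: "arc h" "pathstart h = pt y" "pathfinish h = pt x"
    "path_image h = drawing (walk_edges (y # ys @ [x]))"
    using walk_arc_append[OF d(2) E(2)] .
  show thesis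
  proof
    show "simple_path (g +++ h)"
      using g h loop_arcs_Int[OF assms[unfolded \<alpha>]] by (intro simple_path_join_loop) auto
    show "pathfinish (g +++ h) = pathstart (g +++ h)"
      using g h by simp
    show "path_image (g +++ h) = loop_curve \<alpha>"
      using g h by (simp only: path_image_join loop_curve_eq_drawing \<alpha> cycle_edges_split drawing_Un)
  qed
qed

lemma compact_loop_curve: "compact (loop_curve \<alpha>)"
  unfolding loop_curve_def by (intro compact_UN) auto

lemma open_inside_loop: "open (inside (loop_curve \<alpha>))"
  by (simp add: compact_loop_curve compact_imp_closed open_inside)

lemma bounded_inside_loop: "bounded (inside (loop_curve \<alpha>))"
  by (simp add: bounded_inside compact_imp_bounded compact_loop_curve)

lemma lmeasurable_inside_loop: "inside (loop_curve \<alpha>) \<in> lmeasurable"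
  by (simp add: bounded_inside_loop lmeasurable_open open_inside_loop)

lemma closed_loop_region: "closed (loop_region \<alpha>)"
proof -
  have "loop_region \<alpha> = - outside (loop_curve \<alpha>)"
    by (simp add: loop_region_def union_with_inside)
  then show ?thesis
    by (simp add: closed_Compl compact_imp_closed compact_loop_curve open_outside)
qed

lemma bounded_loop_region: "bounded (loop_region \<alpha>)"
  by (simp add: loop_region_def bounded_inside_loop compact_imp_bounded compact_loop_curve)

lemma inside_loop_curve_disjoint: "inside (loop_curve \<alpha>) \<inter> loop_curve \<alpha> = {}"
  using inside_no_overlap by blast

lemma connected_subset_inside:
  assumes "connected S" "S \<inter> C = {}" "S \<inter> inside C \<noteq> {}"
  shows "S \<subseteq> inside C"
proof -
  obtain z where z: "z \<in> S" "z \<in> inside C"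
    using assms by blast
  have "S \<subseteq> connected_component_set (- C) z"
    using assms z by (intro connected_component_maximal) auto
  then show ?thesis
    using inside_same_component[of C z] z(2) by blast
qed

text \<open>A connected set off the curve cannot pass from the inside to the outside. Taking the closure covers
  open edges together with their endpoints, which may lie on the curve.\<close>

lemma closure_subset_loop_region:
  assumes "connected S" "S \<inter> loop_curve \<alpha> = {}" "closure S \<inter> inside (loop_curve \<alpha>) \<noteq> {}"
  shows "closure S \<subseteq> loop_region \<alpha>"
proof -
  have "S \<inter> inside (loop_curve \<alpha>) \<noteq> {}"
    using assms(3) open_Int_closure_eq_empty[OF open_inside_loop, of \<alpha> S] by blast
  then have "S \<subseteq> loop_region \<alpha>"
    using connected_subset_inside[OF assms(1,2)] by (auto simp: loop_region_def)
  then show ?thesis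
    by (simp add: closed_loop_region closure_minimal)
qed

lemma seg_subset_loop_region:
  assumes "simple_closed_loop \<alpha>" "e \<in> edges square_lattice" "seg e \<inter> inside (loop_curve \<alpha>) \<noteq> {}"
  shows "seg e \<subseteq> loop_region \<alpha>"
proof (cases "e \<in> cycle_edges \<alpha>")
  case True
  then show ?thesis
    by (auto simp: loop_region_def loop_curve_eq_drawing drawing_def)
next
  case False
  then have "open_seg e \<inter> loop_curve \<alpha> = {}"
    using assms by (simp add: loop_curve_eq_drawing open_seg_disjoint_drawing simple_closed_loop_iff)
  then show ?thesis
    using closure_subset_loop_region[of "open_seg e" \<alpha>] assms open_seg_properties[OF assms(2)] by simp
qed

lemma pt_in_loop_curve:
  assumes "simple_closed_loop \<alpha>"
  shows "pt v \<in> loop_curve \<alpha> \<longleftrightarrow> v \<in> set \<alpha>"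
proof -
  have "cycle_edges \<alpha> \<subseteq> edges square_lattice"
    using assms by (simp add: simple_closed_loop_iff)
  then show ?thesis
    using pt_in_drawing[of "cycle_edges \<alpha>" v] Union_cycle_edges[OF assms]
    by (simp add: loop_curve_eq_drawing)
qed

lemma verts_loop_graph: "verts (loop_graph \<alpha>) = {v. pt v \<in> loop_region \<alpha>}"
  by (simp add: loop_graph_def)

lemma edges_loop_graph:
  "edges (loop_graph \<alpha>) = {e \<in> edges square_lattice. seg e \<subseteq> loop_region \<alpha>}"
  unfolding loop_graph_def square_lattice_def graph.simps seg_doubleton[symmetric] by blast

lemma cycle_edges_subset:
  "simple_closed_loop \<alpha> \<Longrightarrow> cycle_edges \<alpha> \<subseteq> edges (loop_graph \<alpha>)"
  by (auto simp: edges_loop_graph simple_closed_loop_iff loop_region_def loop_curve_eq_drawing drawing_def)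

lemma finite_verts_loop_graph: "finite (verts (loop_graph \<alpha>))"
proof -
  obtain r where r: "\<And>z. z \<in> loop_region \<alpha> \<Longrightarrow> cmod z \<le> r"
    using bounded_loop_region[of \<alpha>] by (auto simp: bounded_iff)
  have "verts (loop_graph \<alpha>) \<subseteq> {-\<lceil>r\<rceil>..\<lceil>r\<rceil>} \<times> {-\<lceil>r\<rceil>..\<lceil>r\<rceil>}"
  proof
    fix v assume "v \<in> verts (loop_graph \<alpha>)"
    then have "cmod (pt v) \<le> r"
      using r by (simp add: verts_loop_graph)
    then have "\<bar>real_of_int (fst v)\<bar> \<le> r" "\<bar>real_of_int (snd v)\<bar> \<le> r"
      using abs_Re_le_cmod[of "pt v"] abs_Im_le_cmod[of "pt v"] by (auto simp: pt_def)
    then have "\<bar>fst v\<bar> \<le> \<lceil>r\<rceil>" "\<bar>snd v\<bar> \<le> \<lceil>r\<rceil>"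
      by linarith+
    then show "v \<in> {-\<lceil>r\<rceil>..\<lceil>r\<rceil>} \<times> {-\<lceil>r\<rceil>..\<lceil>r\<rceil>}"
      by (auto simp: mem_Times_iff)
  qed
  then show ?thesis
    by (rule finite_subset) auto
qed

lemma loop_graph_edge_subset: "e \<in> edges (loop_graph \<alpha>) \<Longrightarrow> e \<subseteq> verts (loop_graph \<alpha>)"
  using pt_in_seg by (auto simp: edges_loop_graph verts_loop_graph)

lemma finite_edges_loop_graph: "finite (edges (loop_graph \<alpha>))"
  by (rule finite_subset[of _ "Pow (verts (loop_graph \<alpha>))"])
    (use loop_graph_edge_subset finite_verts_loop_graph in auto)

section \<open>Unit squares inside a loop\<close>

definition unit_square :: "vertex \<Rightarrow> complex set" where
  "unit_square p = box (pt p) (pt (fst p + 1, snd p + 1))"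

lemma unit_square_iff:
  "z \<in> unit_square p \<longleftrightarrow> of_int (fst p) < Re z \<and> Re z < of_int (fst p) + 1 \<and>
     of_int (snd p) < Im z \<and> Im z < of_int (snd p) + 1"
  by (auto simp: unit_square_def in_box_complex_iff pt_def)

lemma closure_unit_square: "closure (unit_square p) = cbox (pt p) (pt (fst p + 1, snd p + 1))"
proof -
  have "Complex (of_int (fst p) + 1/2) (of_int (snd p) + 1/2) \<in> unit_square p"
    by (simp add: unit_square_iff)
  then show ?thesis
    unfolding unit_square_def by (intro closure_box) blast
qed

lemma measure_unit_square: "measure lebesgue (unit_square p) = 1"
  by (simp add: unit_square_def measure_lborel_box_eq Basis_complex_def pt_def)

lemma seg_Int_unit_square:
  assumes "e \<in> edges square_lattice"
  shows "seg e \<inter> unit_square p = {}"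
  using assms
proof (cases rule: lattice_edge_cases)
  case (horizontal a b)
  then show ?thesis by (auto simp: seg_horizontal unit_square_iff)
next
  case (vertical a b)
  then show ?thesis by (auto simp: seg_vertical unit_square_iff)
qed

text \<open>A small shift in the direction \<open>1 + \<i>\<close> moves any point off all lattice lines.\<close>

lemma open_meets_unit_square:
  assumes "open U" "U \<noteq> {}"
  obtains p where "U \<inter> unit_square p \<noteq> {}"
proof -
  obtain z r where r: "r > 0" "ball z r \<subseteq> U"
    using assms open_contains_ball by blast
  let ?a = "\<lfloor>Re z\<rfloor>" and ?b = "\<lfloor>Im z\<rfloor>"
  \<comment> \<open>The shift stays within the ball and does not reach the next lattice line in either direction.\<close>
  define t where "t = min (r / 2) (min (?a + 1 - Re z) (?b + 1 - Im z)) / 2"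
  have t: "t > 0" "t < r / 2" "Re z + t < ?a + 1" "Im z + t < ?b + 1"
    using r(1) floor_less_cancel unfolding t_def by (auto simp: min_def field_simps) linarith+
  have "cmod (Complex t t) \<le> \<bar>t\<bar> + \<bar>t\<bar>"
    using cmod_le[of "Complex t t"] by simp
  then have "z + Complex t t \<in> ball z r"
    using t by (simp add: dist_norm)
  moreover have "z + Complex t t \<in> unit_square (?a, ?b)"
    using t by (simp add: unit_square_iff) linarith
  ultimately show thesis
    using that r(2) by blast
qed

lemma inside_loop_contains_unit_square:
  assumes "simple_closed_loop \<alpha>"
  obtains p where "unit_square p \<subseteq> inside (loop_curve \<alpha>)"
proof -
  obtain c where "simple_path c" "pathfinish c = pathstart c" "path_image c = loop_curve \<alpha>"
    using loop_curve_simple_path[OF assms] .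
  then have "inside (loop_curve \<alpha>) \<noteq> {}"
    using Jordan_inside_outside by metis
  then obtain p where p: "inside (loop_curve \<alpha>) \<inter> unit_square p \<noteq> {}"
    using open_meets_unit_square open_inside_loop by metis
  have "unit_square p \<inter> loop_curve \<alpha> = {}"
    using assms seg_Int_unit_square
    unfolding loop_curve_eq_drawing drawing_def simple_closed_loop_iff by blast
  moreover have "connected (unit_square p)"
    by (simp add: unit_square_def convex_connected)
  ultimately show thesis
    using that[of p] connected_subset_inside p by blast
qed

text \<open>This bound is what makes the integer part of the area decrease when a loop is cut.\<close>

lemma one_le_measure_inside_loop:
  assumes "simple_closed_loop \<alpha>"
  shows "measure lebesgue (inside (loop_curve \<alpha>)) \<ge> 1"
proof -
  obtain p where p: "unit_square p \<subseteq> inside (loop_curve \<alpha>)"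
    using inside_loop_contains_unit_square[OF assms] .
  show ?thesis
    using measure_mono_fmeasurable[OF p _ lmeasurable_inside_loop]
    by (simp add: measure_unit_square, simp add: unit_square_def)
qed

section \<open>Cutting a loop along a chord\<close>

lemma simple_closed_loop_append:
  assumes "xs \<noteq> [] \<or> ys \<noteq> []"
    "distinct (x # xs @ [y])" "distinct (y # ys @ [x])" "set xs \<inter> set ys = {}"
    "walk_edges (x # xs @ [y]) \<subseteq> edges square_lattice"
    "walk_edges (y # ys @ [x]) \<subseteq> edges square_lattice"
  shows "simple_closed_loop (x # xs @ y # ys)"
proof -
  have "length xs + length ys > 0"
    using assms(1) by auto
  then show ?thesis
    using assms unfolding simple_closed_loop_iff cycle_edges_split by auto
qed

text \<open>The loop \<open>\<alpha>\<close> consists of an arc from \<open>x\<close> to \<open>y\<close> through \<open>xs\<close> and an arc back through \<open>ys\<close>; the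
  chord runs from \<open>x\<close> to \<open>y\<close> through \<open>zs\<close>. The three arcs form a theta curve, so the
  inside of \<open>\<alpha>\<close> is the disjoint union of the two partial insides and the open chord. The
  chord is a null set, whence the areas add up.\<close>

lemma chord_split:
  fixes x y xs ys zs
  defines "\<alpha> \<equiv> x # xs @ y # ys" and "\<beta> \<equiv> x # xs @ y # rev zs" and "\<gamma> \<equiv> x # zs @ y # ys"
    and "chord \<equiv> walk_edges (x # zs @ [y])"
  assumes loop: "simple_closed_loop \<alpha>"
    and zs: "distinct zs" "set zs \<inter> set \<alpha> = {}"
    and chord: "chord \<subseteq> edges square_lattice" "chord \<inter> cycle_edges \<alpha> = {}"
      "drawing chord \<inter> inside (loop_curve \<alpha>) \<noteq> {}"
  shows "simple_closed_loop \<beta>" "simple_closed_loop \<gamma>"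
    "loop_region \<beta> \<union> loop_region \<gamma> = loop_region \<alpha>"
    "loop_region \<beta> \<inter> loop_region \<gamma> = drawing chord"
    "measure lebesgue (inside (loop_curve \<alpha>)) =
      measure lebesgue (inside (loop_curve \<beta>)) + measure lebesgue (inside (loop_curve \<gamma>))"
proof -
  define S where "S = walk_edges (x # xs @ [y])"
  define T where "T = walk_edges (y # ys @ [x])"
  have d: "distinct (x # xs @ y # ys)" and ST: "S \<subseteq> edges square_lattice" "T \<subseteq> edges square_lattice"
    using loop by (auto simp: \<alpha>_def simple_closed_loop_iff cycle_edges_split S_def T_def)
  have chord_rev: "walk_edges (y # rev zs @ [x]) = chord"
    using walk_edges_rev[of "x # zs @ [y]"] by (simp add: chord_def)
  have T_rev: "walk_edges (x # rev ys @ [y]) = T"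
    using walk_edges_rev[of "y # ys @ [x]"] by (simp add: T_def)
  have cyc: "cycle_edges \<alpha> = S \<union> T" "cycle_edges \<beta> = S \<union> chord" "cycle_edges \<gamma> = T \<union> chord"
    using chord_rev by (auto simp: \<alpha>_def \<beta>_def \<gamma>_def cycle_edges_split S_def T_def chord_def)
  \<comment> \<open>No loop edge is a chord edge, so neither of the new cycles degenerates to two vertices.\<close>
  have "zs \<noteq> [] \<or> xs \<noteq> []" "zs \<noteq> [] \<or> ys \<noteq> []"
    using chord(2) unfolding cyc by (auto simp: chord_def S_def T_def insert_commute)
  then show loop\<beta>: "simple_closed_loop \<beta>" and loop\<gamma>: "simple_closed_loop \<gamma>"
    using d zs ST chord(1) chord_rev unfolding \<alpha>_def \<beta>_def \<gamma>_def
    by (auto intro!: simple_closed_loop_append simp: S_def T_def chord_def simp del: walk_edges.simps)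
  have sT: "drawing S \<inter> drawing T = {pt x, pt y}"
    using loop_arcs_Int[OF loop[unfolded \<alpha>_def]] by (simp add: S_def T_def)
  have sC: "drawing S \<inter> drawing chord = {pt x, pt y}"
    using loop_arcs_Int[OF loop\<beta>[unfolded \<beta>_def]] chord_rev by (simp add: S_def)
  have tC: "drawing T \<inter> drawing chord = {pt x, pt y}"
    using loop_arcs_Int[OF loop\<gamma>[unfolded \<gamma>_def]] by (auto simp: T_def chord_def)
  have curves: "loop_curve \<alpha> = drawing S \<union> drawing T" "loop_curve \<beta> = drawing S \<union> drawing chord"
    "loop_curve \<gamma> = drawing T \<union> drawing chord"
    by (simp_all add: loop_curve_eq_drawing cyc drawing_Un)
  obtain c1 where c1: "arc c1" "pathstart c1 = pt x" "pathfinish c1 = pt y" "path_image c1 = drawing S"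
    using walk_arc_append[of x xs y] d ST unfolding S_def by auto
  obtain c2 where c2: "arc c2" "pathstart c2 = pt x" "pathfinish c2 = pt y" "path_image c2 = drawing T"
    using walk_arc_append[of x "rev ys" y] d ST unfolding T_rev by auto
  obtain c where c: "arc c" "pathstart c = pt x" "pathfinish c = pt y" "path_image c = drawing chord"
    using walk_arc_append[of x zs y] d zs chord unfolding chord_def \<alpha>_def by auto
  have "pt x \<noteq> pt y"
    using d inj_pt by (auto simp: inj_eq)
  then have parts: "inside (loop_curve \<beta>) \<inter> inside (loop_curve \<gamma>) = {}"
    "inside (loop_curve \<beta>) \<union> inside (loop_curve \<gamma>) \<union> (drawing chord - {pt x, pt y}) =
      inside (loop_curve \<alpha>)"
    using split_inside_simple_closed_curve[of c1 "pt x" "pt y" c2 c] c1 c2 c sT sC tC chord(3)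
    by (auto simp: arc_imp_simple_path curves)
  show "loop_region \<beta> \<union> loop_region \<gamma> = loop_region \<alpha>"
    using parts sT sC unfolding loop_region_def curves by blast
  have "inside (loop_curve \<beta>) \<inter> drawing T = {}" "inside (loop_curve \<gamma>) \<inter> drawing S = {}"
    using parts inside_loop_curve_disjoint[of \<alpha>] unfolding curves by blast+
  then show "loop_region \<beta> \<inter> loop_region \<gamma> = drawing chord"
    using parts(1) inside_loop_curve_disjoint[of \<beta>] inside_loop_curve_disjoint[of \<gamma>] sT sC
    unfolding loop_region_def curves by blast
  have "measure lebesgue (inside (loop_curve \<alpha>)) =
      measure lebesgue (inside (loop_curve \<beta>) \<union> inside (loop_curve \<gamma>))"
  proof (rule measure_negligible_symdiff)
    show "inside (loop_curve \<beta>) \<union> inside (loop_curve \<gamma>) \<in> lmeasurable"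
      by (simp add: fmeasurable.Un lmeasurable_inside_loop)
    show "negligible (inside (loop_curve \<beta>) \<union> inside (loop_curve \<gamma>) - inside (loop_curve \<alpha>) \<union>
        (inside (loop_curve \<alpha>) - (inside (loop_curve \<beta>) \<union> inside (loop_curve \<gamma>))))"
      by (rule negligible_subset[OF negligible_loop_curve[of \<beta>]]) (use parts curves in blast)
  qed
  also have "\<dots> = measure lebesgue (inside (loop_curve \<beta>)) + measure lebesgue (inside (loop_curve \<gamma>))"
    by (simp add: measure_Un3 lmeasurable_inside_loop parts(1))
  finally show "measure lebesgue (inside (loop_curve \<alpha>)) =
      measure lebesgue (inside (loop_curve \<beta>)) + measure lebesgue (inside (loop_curve \<gamma>))" .
qed

lemma card_walk_edges:
  "distinct xs \<Longrightarrow> card (walk_edges xs) = length xs - 1"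
proof (induction xs rule: walk_edges.induct)
  case (1 x y xs)
  have "\<Union>(walk_edges (y # xs)) \<subseteq> set (y # xs)"
    using Union_walk_edges[of y] by (cases xs) auto
  then have "{x, y} \<notin> walk_edges (y # xs)"
    using 1 by auto
  moreover have "finite (walk_edges (y # xs))"
    unfolding walk_edges_conv_nth by simp
  ultimately show ?case
    using 1 by simp
qed auto

definition euler_formula where
  "euler_formula \<alpha> \<longleftrightarrow> real (card (verts (loop_graph \<alpha>))) + measure lebesgue (inside (loop_curve \<alpha>)) =
    real (card (edges (loop_graph \<alpha>))) + 1"

text \<open>By inclusion and exclusion, the vertices and edges of the chord are the only ones counted twice.
  The chord has \<open>length zs + 2\<close> vertices and \<open>length zs + 1\<close> edges, and this difference of one
  turns the two constants \<open>1\<close> of the pieces into a single one. Every edge of the loop graph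
  belongs to one of the pieces, since an open edge cannot cross the chord.\<close>

lemma euler_glue:
  fixes x y xs ys zs
  defines "\<alpha> \<equiv> x # xs @ y # ys" and "\<beta> \<equiv> x # xs @ y # rev zs" and "\<gamma> \<equiv> x # zs @ y # ys"
    and "chord \<equiv> walk_edges (x # zs @ [y])"
  assumes loop: "simple_closed_loop \<alpha>"
    and zs: "distinct zs" "set zs \<inter> set \<alpha> = {}"
    and chord: "chord \<subseteq> edges square_lattice" "chord \<inter> cycle_edges \<alpha> = {}"
      "drawing chord \<inter> inside (loop_curve \<alpha>) \<noteq> {}"
    and euler: "euler_formula \<beta>" "euler_formula \<gamma>"
  shows "euler_formula \<alpha>"
proof -
  note split = chord_split[OF loop[unfolded \<alpha>_def] zs[unfolded \<alpha>_def] chord[unfolded \<alpha>_def chord_def],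
      folded \<alpha>_def \<beta>_def \<gamma>_def chord_def]
  have d: "distinct (x # zs @ [y])"
    using loop zs by (auto simp: simple_closed_loop_iff \<alpha>_def)
  have V: "verts (loop_graph \<beta>) \<union> verts (loop_graph \<gamma>) = verts (loop_graph \<alpha>)"
    unfolding verts_loop_graph split(3)[symmetric] by blast
  have "verts (loop_graph \<beta>) \<inter> verts (loop_graph \<gamma>) = {v. pt v \<in> drawing chord}"
    unfolding verts_loop_graph split(4)[symmetric] by blast
  also have "\<dots> = set (x # zs @ [y])"
    using pt_in_drawing[OF chord(1)] Union_walk_edges_append[of x zs y] by (auto simp: chord_def)
  finally have V': "card (verts (loop_graph \<beta>) \<inter> verts (loop_graph \<gamma>)) = length zs + 2"
    using distinct_card[OF d] by simp
  have E: "edges (loop_graph \<beta>) \<union> edges (loop_graph \<gamma>) = edges (loop_graph \<alpha>)"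
  proof
    show "edges (loop_graph \<beta>) \<union> edges (loop_graph \<gamma>) \<subseteq> edges (loop_graph \<alpha>)"
      unfolding edges_loop_graph split(3)[symmetric] by blast
    show "edges (loop_graph \<alpha>) \<subseteq> edges (loop_graph \<beta>) \<union> edges (loop_graph \<gamma>)"
    proof
      fix e assume "e \<in> edges (loop_graph \<alpha>)"
      then have e: "e \<in> edges square_lattice" "seg e \<subseteq> loop_region \<beta> \<union> loop_region \<gamma>"
        unfolding edges_loop_graph split(3) by blast+
      show "e \<in> edges (loop_graph \<beta>) \<union> edges (loop_graph \<gamma>)"
      proof (cases "e \<in> cycle_edges \<beta> \<union> cycle_edges \<gamma>")
        case True
        then show ?thesis
          using cycle_edges_subset split(1,2) by blast
      next
        case False
        then have "open_seg e \<inter> loop_curve \<beta> = {}" "open_seg e \<inter> loop_curve \<gamma> = {}"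
          using split(1,2) e(1)
          by (simp_all add: loop_curve_eq_drawing simple_closed_loop_iff open_seg_disjoint_drawing)
        then have "seg e \<inter> inside (loop_curve \<beta>) \<noteq> {} \<or> seg e \<inter> inside (loop_curve \<gamma>) \<noteq> {}"
          using e(2) open_seg_properties(1)[OF e(1)] unfolding loop_region_def open_seg_def by blast
        then show ?thesis
          using seg_subset_loop_region split(1,2) e(1) unfolding edges_loop_graph by blast
      qed
    qed
  qed
  have "edges (loop_graph \<beta>) \<inter> edges (loop_graph \<gamma>) = {e \<in> edges square_lattice. seg e \<subseteq> drawing chord}"
    unfolding edges_loop_graph split(4)[symmetric] by blast
  also have "\<dots> = chord"
    using seg_subset_drawing_iff[OF chord(1)] chord(1) by blast
  finally have E': "card (edges (loop_graph \<beta>) \<inter> edges (loop_graph \<gamma>)) = length zs + 1"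
    using card_walk_edges[OF d] by (simp add: chord_def)
  have "card (verts (loop_graph \<beta>)) + card (verts (loop_graph \<gamma>)) =
      card (verts (loop_graph \<alpha>)) + (length zs + 2)"
    using card_Un_Int[OF finite_verts_loop_graph finite_verts_loop_graph, of \<beta> \<gamma>] V V' by simp
  moreover have "card (edges (loop_graph \<beta>)) + card (edges (loop_graph \<gamma>)) =
      card (edges (loop_graph \<alpha>)) + (length zs + 1)"
    using card_Un_Int[OF finite_edges_loop_graph finite_edges_loop_graph, of \<beta> \<gamma>] E E' by simp
  ultimately show ?thesis
    using euler split(5) unfolding euler_formula_def by linarith
qed

section \<open>Existence of chords\<close>

definition lattice_line :: "vertex \<Rightarrow> vertex \<Rightarrow> int \<Rightarrow> vertex" where
  "lattice_line p d j = (fst p + j * fst d, snd p + j * snd d)"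

lemma lattice_line_inj:
  assumes "\<bar>fst d\<bar> + \<bar>snd d\<bar> = 1"
  shows "lattice_line p d i = lattice_line p d j \<longleftrightarrow> i = j"
  using assms by (auto simp: lattice_line_def)

lemma lattice_line_edge:
  assumes "\<bar>fst d\<bar> + \<bar>snd d\<bar> = 1"
  shows "{lattice_line p d j, lattice_line p d (j + 1)} \<in> edges square_lattice"
  using assms by (simp add: edge_iff adj_iff lattice_line_def algebra_simps)

text \<open>Otherwise the ray would never leave the inside, which contains only finitely many lattice points.\<close>

lemma ray_hits_loop:
  assumes loop: "simple_closed_loop \<alpha>" and d: "\<bar>fst d\<bar> + \<bar>snd d\<bar> = 1"
    and p: "p \<in> verts (loop_graph \<alpha>)"
  shows "\<exists>n::nat. lattice_line p d (int n) \<in> set \<alpha>"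
proof (rule ccontr)
  assume no: "\<not> ?thesis"
  have "lattice_line p d (int n) \<in> verts (loop_graph \<alpha>)" for n
  proof (induction n)
    case 0
    then show ?case using p by (simp add: lattice_line_def)
  next
    case (Suc n)
    let ?e = "{lattice_line p d (int n), lattice_line p d (int n + 1)}"
    have e: "?e \<in> edges square_lattice"
      using lattice_line_edge[OF d] .
    have "pt (lattice_line p d (int n)) \<in> inside (loop_curve \<alpha>)"
      using Suc no pt_in_loop_curve[OF loop] unfolding verts_loop_graph loop_region_def by blast
    then have "seg ?e \<subseteq> loop_region \<alpha>"
      using seg_subset_loop_region[OF loop e] pt_in_seg[OF e] by blast
    then show ?case
      using pt_in_seg[OF e, of "lattice_line p d (int n + 1)"] unfolding verts_loop_graph
      by (auto simp: add.commute)
  qed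
  then have "range (\<lambda>n. lattice_line p d (int n)) \<subseteq> verts (loop_graph \<alpha>)"
    by blast
  moreover have "inj (\<lambda>n. lattice_line p d (int n))"
    by (rule injI) (simp add: lattice_line_inj[OF d])
  ultimately show False
    using finite_verts_loop_graph finite_subset range_inj_infinite by blast
qed

lemma walk_edges_map_upto:
  "walk_edges (map f [a..b]) = {{f j, f (j + 1)} | j. a \<le> j \<and> j < b}"
proof (intro subset_antisym subsetI)
  fix e assume "e \<in> walk_edges (map f [a..b])"
  then obtain i where "e = {map f [a..b] ! i, map f [a..b] ! Suc i}" "Suc i < length (map f [a..b])"
    unfolding walk_edges_conv_nth by blast
  then have "e = {f (a + int i), f (a + int i + 1)} \<and> a \<le> a + int i \<and> a + int i < b"
    by (simp add: algebra_simps)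
  then show "e \<in> {{f j, f (j + 1)} | j. a \<le> j \<and> j < b}"
    by blast
next
  fix e assume "e \<in> {{f j, f (j + 1)} | j. a \<le> j \<and> j < b}"
  then obtain j where "e = {f j, f (j + 1)}" "a \<le> j" "j < b"
    by blast
  then have "e = {map f [a..b] ! nat (j - a), map f [a..b] ! Suc (nat (j - a))} \<and>
      Suc (nat (j - a)) < length (map f [a..b])"
    by (simp add: algebra_simps)
  then show "e \<in> walk_edges (map f [a..b])"
    unfolding walk_edges_conv_nth by blast
qed

text \<open>Follow the line of \<open>e\<close> from its two endpoints in opposite directions to the first vertices on the loop.
  Edges of this chord other than \<open>e\<close> have an endpoint off the loop, so none of them is a loop edge.\<close>

lemma chord_exists:
  assumes loop: "simple_closed_loop \<alpha>" and e: "e \<in> edges (loop_graph \<alpha>)" "e \<notin> cycle_edges \<alpha>"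
  obtains x zs y where "x \<in> set \<alpha>" "y \<in> set \<alpha>" "distinct (x # zs @ [y])" "set zs \<inter> set \<alpha> = {}"
    "walk_edges (x # zs @ [y]) \<subseteq> edges square_lattice" "walk_edges (x # zs @ [y]) \<inter> cycle_edges \<alpha> = {}"
    "drawing (walk_edges (x # zs @ [y])) \<inter> inside (loop_curve \<alpha>) \<noteq> {}"
proof -
  have e': "e \<in> edges square_lattice" "seg e \<subseteq> loop_region \<alpha>"
    using e by (auto simp: edges_loop_graph)
  obtain p d where d: "\<bar>fst d\<bar> + \<bar>snd d\<bar> = 1"
    and pd: "e = {lattice_line p d 0, lattice_line p d 1}"
    using e'(1)
  proof (cases rule: lattice_edge_cases)
    case (horizontal a b)
    then show ?thesis using that[of "(1, 0)" "(a, b)"] by (simp add: lattice_line_def)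
  next
    case (vertical a b)
    then show ?thesis using that[of "(0, 1)" "(a, b)"] by (simp add: lattice_line_def)
  qed
  define f where "f = lattice_line p d"
  have V: "f 0 \<in> verts (loop_graph \<alpha>)" "f 1 \<in> verts (loop_graph \<alpha>)"
    using loop_graph_edge_subset[OF e(1)] pd by (auto simp: f_def)
  have "\<exists>n. lattice_line (f 1) d (int n) \<in> set \<alpha>"
    using ray_hits_loop[OF loop d V(2)] .
  then have ex_n: "\<exists>n. f (1 + int n) \<in> set \<alpha>"
    by (simp add: f_def lattice_line_def algebra_simps)
  have "\<exists>n. lattice_line (f 0) (- d) (int n) \<in> set \<alpha>"
    by (rule ray_hits_loop[OF loop _ V(1)]) (use d in simp)
  then have ex_m: "\<exists>m. f (- int m) \<in> set \<alpha>"
    by (simp add: f_def lattice_line_def algebra_simps)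
  \<comment> \<open>The edge \<open>e\<close> joins the positions \<open>0\<close> and \<open>1\<close> of its line; the chord occupies the positions
    from \<open>a\<close> to \<open>b\<close>.\<close>
  define b where "b = 1 + int (LEAST n. f (1 + int n) \<in> set \<alpha>)"
  define a where "a = - int (LEAST m. f (- int m) \<in> set \<alpha>)"
  have ab: "f a \<in> set \<alpha>" "f b \<in> set \<alpha>" "a \<le> 0" "1 \<le> b"
    using LeastI_ex[OF ex_n] LeastI_ex[OF ex_m] by (auto simp: a_def b_def)
  have between: "f j \<notin> set \<alpha>" if "a < j" "j < b" for j
  proof (cases "j \<ge> 1")
    case True
    then have "nat (j - 1) < (LEAST n. f (1 + int n) \<in> set \<alpha>)"
      using that by (auto simp: b_def)
    then show ?thesis
      using not_less_Least[of "nat (j - 1)"] True by fastforce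
  next
    case False
    then have "nat (- j) < (LEAST m. f (- int m) \<in> set \<alpha>)"
      using that by (auto simp: a_def)
    then show ?thesis
      using not_less_Least[of "nat (- j)"] False by fastforce
  qed
  define zs where "zs = map f [a + 1..b - 1]"
  have "[a..b] = a # [a + 1..b]" "[a + 1..b] = [a + 1..b - 1] @ [b]"
    using ab upto_rec1[of a b] upto_rec2[of "a + 1" b] by auto
  then have path: "map f [a..b] = f a # zs @ [f b]"
    by (simp add: zs_def)
  have edges: "walk_edges (f a # zs @ [f b]) = {{f j, f (j + 1)} | j. a \<le> j \<and> j < b}"
    unfolding path[symmetric] by (rule walk_edges_map_upto)
  have no_cycle: "{f j, f (j + 1)} \<notin> cycle_edges \<alpha>" if j: "a \<le> j" "j < b" for j
  proof (cases "j = 0")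
    case True
    then show ?thesis using e(2) pd by (simp add: f_def)
  next
    case False
    then have "f j \<notin> set \<alpha> \<or> f (j + 1) \<notin> set \<alpha>"
      using between[of j] between[of "j + 1"] j ab by fastforce
    then show ?thesis
      using Union_cycle_edges[OF loop] by blast
  qed
  show thesis
  proof
    show "f a \<in> set \<alpha>" "f b \<in> set \<alpha>"
      by fact+
    show "distinct (f a # zs @ [f b])"
      unfolding path[symmetric] by (simp add: distinct_map inj_on_def f_def lattice_line_inj[OF d])
    show "set zs \<inter> set \<alpha> = {}"
      using between by (auto simp: zs_def)
    show "walk_edges (f a # zs @ [f b]) \<subseteq> edges square_lattice"
      unfolding edges by (auto simp only: f_def lattice_line_edge[OF d])
    show "walk_edges (f a # zs @ [f b]) \<inter> cycle_edges \<alpha> = {}"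
      unfolding edges using no_cycle by blast
    have "e = {f 0, f (0 + 1)}" "a \<le> 0 \<and> 0 < b"
      using ab pd by (auto simp: f_def)
    then have "e \<in> walk_edges (f a # zs @ [f b])"
      unfolding edges by blast
    moreover have "open_seg e \<inter> loop_curve \<alpha> = {}"
      using e(2) e'(1) loop
      by (simp add: loop_curve_eq_drawing simple_closed_loop_iff open_seg_disjoint_drawing)
    then have "seg e \<inter> inside (loop_curve \<alpha>) \<noteq> {}"
      using e'(2) open_seg_properties(1)[OF e'(1)] unfolding loop_region_def open_seg_def by blast
    ultimately show "drawing (walk_edges (f a # zs @ [f b])) \<inter> inside (loop_curve \<alpha>) \<noteq> {}"
      unfolding drawing_def by blast
  qed
qed

lemma loop_rotation:
  assumes loop: "simple_closed_loop \<alpha>" and xy: "x \<in> set \<alpha>" "y \<in> set \<alpha>" "x \<noteq> y"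
  obtains xs ys where "simple_closed_loop (x # xs @ y # ys)"
    "cycle_edges (x # xs @ y # ys) = cycle_edges \<alpha>" "set (x # xs @ y # ys) = set \<alpha>"
proof -
  obtain us vs where uv: "\<alpha> = us @ x # vs"
    using xy(1) by (metis split_list)
  define \<rho> where "\<rho> = rotate (length us) \<alpha>"
  have \<rho>: "\<rho> = x # vs @ us"
    by (simp add: \<rho>_def uv rotate_append)
  then have "y \<in> set (vs @ us)"
    using xy uv by auto
  then obtain xs ys where "vs @ us = xs @ y # ys"
    by (metis split_list)
  then have \<rho>': "x # xs @ y # ys = \<rho>"
    using \<rho> by simp
  show thesis
  proof
    show "cycle_edges (x # xs @ y # ys) = cycle_edges \<alpha>" "set (x # xs @ y # ys) = set \<alpha>"
      unfolding \<rho>' by (simp_all add: \<rho>_def cycle_edges_rotate)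
    show "simple_closed_loop (x # xs @ y # ys)"
      using loop unfolding \<rho>' by (simp add: simple_closed_loop_iff \<rho>_def cycle_edges_rotate)
  qed
qed

section \<open>Euler's formula for a loop graph\<close>

text \<open>Some unit square lies inside the loop. Its sides are edges of the loop graph, hence by assumption part
  of the loop, so the connected inside cannot leave the square.\<close>

lemma inside_eq_unit_square:
  assumes loop: "simple_closed_loop \<alpha>" and E: "edges (loop_graph \<alpha>) = cycle_edges \<alpha>"
  obtains p where "inside (loop_curve \<alpha>) = unit_square p"
proof -
  obtain p where p: "unit_square p \<subseteq> inside (loop_curve \<alpha>)"
    using inside_loop_contains_unit_square[OF loop] .
  obtain a b where ab: "p = (a, b)"
    by (cases p)
  have conn: "connected (inside (loop_curve \<alpha>))"
    using loop_curve_simple_path[OF loop] Jordan_inside_outside by metis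
  have closure: "closure (unit_square p) =
      {z. of_int a \<le> Re z \<and> Re z \<le> of_int a + 1 \<and> of_int b \<le> Im z \<and> Im z \<le> of_int b + 1}"
    unfolding closure_unit_square by (auto simp: in_cbox_complex_iff pt_def ab)
  have ne: "unit_square p \<noteq> {}"
    using measure_unit_square[of p] by auto
  have "unit_square p \<subseteq> loop_region \<alpha>"
    using p by (auto simp: loop_region_def)
  then have region: "closure (unit_square p) \<subseteq> loop_region \<alpha>"
    by (simp add: closed_loop_region closure_minimal)
  have side: "seg e \<subseteq> loop_curve \<alpha>"
    if "e \<in> edges square_lattice" "seg e \<subseteq> closure (unit_square p)" for e
  proof -
    have "e \<in> edges (loop_graph \<alpha>)"
      using that region by (auto simp: edges_loop_graph)
    then show ?thesis
      unfolding E loop_curve_eq_drawing drawing_def by blast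
  qed
  have "frontier (unit_square p) \<subseteq> loop_curve \<alpha>"
  proof
    fix z assume z: "z \<in> frontier (unit_square p)"
    have "open (unit_square p)"
      by (simp only: unit_square_def open_box)
    then have z': "z \<in> closure (unit_square p)" "z \<notin> unit_square p"
      using z by (auto simp: frontier_def interior_open)
    then consider "Re z = of_int a" | "Re z = of_int (a + 1)" | "Im z = of_int b" | "Im z = of_int (b + 1)"
      unfolding closure by (force simp: unit_square_iff ab not_less)
    then have "z \<in> seg {(a, b), (a, b + 1)} \<or> z \<in> seg {(a + 1, b), (a + 1, b + 1)} \<or>
        z \<in> seg {(a, b), (a + 1, b)} \<or> z \<in> seg {(a, b + 1), (a + 1, b + 1)}"
      using z'(1) unfolding closure seg_horizontal seg_vertical by cases auto
    moreover have "seg {(a, b), (a, b + 1)} \<subseteq> loop_curve \<alpha>" "seg {(a + 1, b), (a + 1, b + 1)} \<subseteq> loop_curve \<alpha>"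
      "seg {(a, b), (a + 1, b)} \<subseteq> loop_curve \<alpha>" "seg {(a, b + 1), (a + 1, b + 1)} \<subseteq> loop_curve \<alpha>"
      by (rule side; auto simp: edge_iff adj_iff closure seg_horizontal seg_vertical)+
    ultimately show "z \<in> loop_curve \<alpha>"
      by blast
  qed
  then have "inside (loop_curve \<alpha>) \<inter> frontier (unit_square p) = {}"
    using inside_loop_curve_disjoint[of \<alpha>] by blast
  then have "inside (loop_curve \<alpha>) \<subseteq> unit_square p"
    using connected_Int_frontier[OF conn, of "unit_square p"] p ne by blast
  then show thesis
    using that p by blast
qed

text \<open>A vertex off the loop would lie inside and have an incident edge in the loop graph that is not in
  the loop. So vertices and edges are those of the loop, equal in number, and the area is one.\<close>

lemma euler_base:
  assumes loop: "simple_closed_loop \<alpha>" and E: "edges (loop_graph \<alpha>) = cycle_edges \<alpha>"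
  shows "euler_formula \<alpha>"
proof -
  have "verts (loop_graph \<alpha>) = set \<alpha>"
  proof (intro subset_antisym subsetI)
    fix v assume "v \<in> set \<alpha>"
    then show "v \<in> verts (loop_graph \<alpha>)"
      using pt_in_loop_curve[OF loop] by (simp add: verts_loop_graph loop_region_def)
  next
    fix v assume v: "v \<in> verts (loop_graph \<alpha>)"
    show "v \<in> set \<alpha>"
    proof (rule ccontr)
      assume "v \<notin> set \<alpha>"
      then have "pt v \<in> inside (loop_curve \<alpha>)"
        using v pt_in_loop_curve[OF loop] by (simp add: verts_loop_graph loop_region_def)
      moreover define e where "e = {v, (fst v + 1, snd v)}"
      moreover have e: "e \<in> edges square_lattice"
        by (simp add: e_def edge_iff adj_iff)
      ultimately have "e \<in> edges (loop_graph \<alpha>)"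
        using seg_subset_loop_region[OF loop e] pt_in_seg[OF e, of v] by (auto simp: edges_loop_graph)
      then show False
        using \<open>v \<notin> set \<alpha>\<close> Union_cycle_edges[OF loop] by (auto simp: E e_def)
    qed
  qed
  then have "card (verts (loop_graph \<alpha>)) = length \<alpha>"
    using loop by (simp add: distinct_card simple_closed_loop_iff)
  moreover obtain p where "inside (loop_curve \<alpha>) = unit_square p"
    using inside_eq_unit_square[OF loop E] .
  ultimately show ?thesis
    by (simp add: euler_formula_def E card_cycle_edges[OF loop] measure_unit_square)
qed

lemma euler_formula_loop: "simple_closed_loop \<alpha> \<Longrightarrow> euler_formula \<alpha>"
proof (induction "nat \<lfloor>measure lebesgue (inside (loop_curve \<alpha>))\<rfloor>" arbitrary: \<alpha> rule: less_induct)
  case less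
  note loop = less.prems
  show ?case
  proof (cases "edges (loop_graph \<alpha>) = cycle_edges \<alpha>")
    case True
    then show ?thesis
      using euler_base loop by blast
  next
    case False
    then obtain e where "e \<in> edges (loop_graph \<alpha>)" "e \<notin> cycle_edges \<alpha>"
      using cycle_edges_subset[OF loop] by blast
    then obtain x zs y where chord: "x \<in> set \<alpha>" "y \<in> set \<alpha>" "distinct (x # zs @ [y])"
      "set zs \<inter> set \<alpha> = {}" "walk_edges (x # zs @ [y]) \<subseteq> edges square_lattice"
      "walk_edges (x # zs @ [y]) \<inter> cycle_edges \<alpha> = {}"
      "drawing (walk_edges (x # zs @ [y])) \<inter> inside (loop_curve \<alpha>) \<noteq> {}"
      using chord_exists[OF loop] by metis
    then have "x \<noteq> y"
      by auto
    \<comment> \<open>The same closed curve, listed from the start of the chord.\<close>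
    then obtain xs ys where rot: "simple_closed_loop (x # xs @ y # ys)"
      "cycle_edges (x # xs @ y # ys) = cycle_edges \<alpha>" "set (x # xs @ y # ys) = set \<alpha>"
      using loop_rotation[OF loop chord(1,2)] by metis
    define \<rho> where "\<rho> = x # xs @ y # ys"
    have curve: "loop_curve \<rho> = loop_curve \<alpha>"
      by (simp add: loop_curve_eq_drawing rot(2) \<rho>_def)
    then have graph: "loop_graph \<rho> = loop_graph \<alpha>"
      by (simp add: loop_graph_def loop_region_def)
    have zs: "distinct zs" "set zs \<inter> set (x # xs @ y # ys) = {}"
      "walk_edges (x # zs @ [y]) \<inter> cycle_edges (x # xs @ y # ys) = {}"
      "drawing (walk_edges (x # zs @ [y])) \<inter> inside (loop_curve (x # xs @ y # ys)) \<noteq> {}"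
      using chord curve unfolding rot \<rho>_def by auto
    let ?\<beta> = "x # xs @ y # rev zs" and ?\<gamma> = "x # zs @ y # ys"
    note split = chord_split[OF rot(1) zs(1,2) chord(5) zs(3,4)]
    have "measure lebesgue (inside (loop_curve \<alpha>)) =
      measure lebesgue (inside (loop_curve ?\<beta>)) + measure lebesgue (inside (loop_curve ?\<gamma>))"
      using split(5) curve by (simp add: \<rho>_def)
    then have "nat \<lfloor>measure lebesgue (inside (loop_curve ?\<beta>))\<rfloor> < nat \<lfloor>measure lebesgue (inside (loop_curve \<alpha>))\<rfloor>"
      "nat \<lfloor>measure lebesgue (inside (loop_curve ?\<gamma>))\<rfloor> < nat \<lfloor>measure lebesgue (inside (loop_curve \<alpha>))\<rfloor>"
      using one_le_measure_inside_loop[OF split(1)] one_le_measure_inside_loop[OF split(2)]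
      by linarith+
    then have "euler_formula ?\<beta>" "euler_formula ?\<gamma>"
      using less.hyps split(1,2) by blast+
    then have "euler_formula \<rho>"
      unfolding \<rho>_def using euler_glue[OF rot(1) zs(1,2) chord(5) zs(3,4)] by blast
    then show ?thesis
      by (simp add: euler_formula_def curve graph)
  qed
qed

lemma euler_simple_grid_graph:
  assumes "simple_grid_graph G"
  shows "real (card (edges G)) = real (card (verts G)) + area G - 1"
proof -
  obtain \<alpha> where "simple_closed_loop \<alpha>" "G = loop_graph \<alpha>"
    using assms by (auto simp: simple_grid_graph_def)
  then show ?thesis
    using euler_formula_loop[of \<alpha>] by (simp add: euler_formula_def area_loop_graph)
qed

section \<open>Counting cut edges\<close>

lemma edges_partition:
  assumes "subgraph G square_lattice" "partition_on (verts G) P"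
  shows "edges G - cut_edges G P = (\<Union>W\<in>P. edges (induced_subgraph G W))"
    and "disjoint_family_on (\<lambda>W. edges (induced_subgraph G W)) P"
proof -
  show "edges G - cut_edges G P = (\<Union>W\<in>P. edges (induced_subgraph G W))"
  proof (intro subset_antisym subsetI)
    fix e assume e: "e \<in> edges G - cut_edges G P"
    then have "e \<in> edges square_lattice" "e \<subseteq> verts G"
      using assms(1) by (auto simp: subgraph_def)
    then obtain u v where uv: "e = {u, v}" "u \<in> \<Union>P" "v \<in> \<Union>P"
      using partition_onD1[OF assms(2)] by (auto simp: square_lattice_def)
    then obtain A B where "A \<in> P" "B \<in> P" "u \<in> A" "v \<in> B"
      by blast
    moreover from this have "A = B"
      using e uv(1) unfolding cut_edges_def by blast
    ultimately show "e \<in> (\<Union>W\<in>P. edges (induced_subgraph G W))"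
      using e uv(1) by (auto simp: induced_subgraph_def)
  next
    fix e assume "e \<in> (\<Union>W\<in>P. edges (induced_subgraph G W))"
    then obtain W where W: "W \<in> P" "e \<in> edges G" "e \<subseteq> W"
      by (auto simp: induced_subgraph_def)
    have "A = W" if "A \<in> P" "u \<in> A" "u \<in> e" for A u
      using partition_onD2[OF assms(2)] W that by (auto simp: disjoint_def)
    then show "e \<in> edges G - cut_edges G P"
      using W(2) unfolding cut_edges_def by blast
  qed
  show "disjoint_family_on (\<lambda>W. edges (induced_subgraph G W)) P"
    unfolding disjoint_family_on_def
  proof (intro ballI impI)
    fix A B assume AB: "A \<in> P" "B \<in> P" "A \<noteq> B"
    have "A \<inter> B = {}"
      using partition_onD2[OF assms(2)] AB by (auto simp: disjoint_def)
    moreover have "e \<noteq> {}" if "e \<in> edges G" for e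
      using that assms(1) by (auto simp: subgraph_def square_lattice_def)
    ultimately show "edges (induced_subgraph G A) \<inter> edges (induced_subgraph G B) = {}"
      unfolding induced_subgraph_def graph.simps by blast
  qed
qed

theorem proposition7p1:
  fixes G :: graph and K :: nat and V :: "nat \<Rightarrow> (int \<times> int) set"
  assumes "simple_grid_graph G"
    and "partition_on (verts G) (V ` {1..K})"
    and "inj_on V {1..K}"
    and "\<And>i. i \<in> {1..K} \<Longrightarrow> simple_grid_graph (induced_subgraph G (V i))"
  shows "real (card (cut_edges G (V ` {1..K}))) =
    area G + real K - 1 - (\<Sum>i = 1..K. area (induced_subgraph G (V i)))"
proof -
  let ?H = "\<lambda>i. induced_subgraph G (V i)" and ?P = "V ` {1..K}"
  have sub: "subgraph G square_lattice" and finV: "finite (verts G)"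
    using assms(1) by (auto simp: simple_grid_graph_def grid_graph_def)
  have finE: "finite (edges G)"
    by (rule finite_subset[of _ "Pow (verts G)"]) (use sub finV in \<open>auto simp: subgraph_def\<close>)
  have cut: "cut_edges G ?P \<subseteq> edges G"
    by (auto simp: cut_edges_def)
  have part: "W \<subseteq> verts G" if "W \<in> ?P" for W
    using partition_onD1[OF assms(2)] that by blast
  have "card (edges G - cut_edges G ?P) = (\<Sum>W\<in>?P. card (edges (induced_subgraph G W)))"
    unfolding edges_partition(1)[OF sub assms(2)]
  proof (rule card_UN_disjoint')
    show "disjoint_family_on (\<lambda>W. edges (induced_subgraph G W)) ?P"
      by (rule edges_partition(2)[OF sub assms(2)])
    show "finite (edges (induced_subgraph G W))" for W
      by (rule finite_subset[OF _ finE]) (auto simp: induced_subgraph_def)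
  qed simp
  also have "\<dots> = (\<Sum>i = 1..K. card (edges (?H i)))"
    by (subst sum.reindex[OF assms(3)]) simp
  finally have "real (card (edges G)) - real (card (cut_edges G ?P)) = (\<Sum>i = 1..K. real (card (edges (?H i))))"
    using card_Diff_subset[OF finite_subset[OF cut finE] cut] card_mono[OF finE cut]
    by (simp flip: of_nat_sum of_nat_diff)
  also have "\<dots> = (\<Sum>i = 1..K. real (card (V i)) + area (?H i) - 1)"
  proof (rule sum.cong[OF refl])
    fix i assume "i \<in> {1..K}"
    then have "verts (?H i) = V i" "simple_grid_graph (?H i)"
      using part[of "V i"] assms(4) by (auto simp only: induced_subgraph_def graph.simps)
    then show "real (card (edges (?H i))) = real (card (V i)) + area (?H i) - 1"
      using euler_simple_grid_graph by metis
  qed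
  also have "\<dots> = (\<Sum>i = 1..K. real (card (V i))) + (\<Sum>i = 1..K. area (?H i)) - real K"
    by (simp add: sum.distrib sum_subtractf)
  also have "(\<Sum>i = 1..K. real (card (V i))) = real (card (verts G))"
  proof -
    have "card (verts G) = (\<Sum>W\<in>?P. card W)"
      using product_partition[OF assms(2)] part finV finite_subset by metis
    then show ?thesis
      by (subst (asm) sum.reindex[OF assms(3)]) simp
  qed
  finally show ?thesis
    using euler_simple_grid_graph[OF assms(1)] by linarith
qed

end
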